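(* Let $\mathbb{F}_q$ be a finite field of characteristic $p$, and let $n\ge 3$, $m\ge 2$, $k\ge 2$ be integers with $p\nmid mk$ and $mk>n$. Let $a,b,a_1,\dots,a_n\in\mathbb{F}_q^*$ and $$f=(a_1X_1^m+\cdots+a_nX_n^m+a)^k-bX_1\cdots X_n\in\mathbb{F}_q[X_1,\dots,X_n].$$ Let $V_f=\{f=0\}\subset\mathbb{A}^n$ be the affine hypersurface defined by $f$. Then the singular locus $\mathrm{sing}(V_f)$ of $V_f$ has dimension at most $n-3$.
   Context: $\mathbb{A}^n$ denotes affine $n$-space over the algebraic closure $\overline{\mathbb{F}}_q$; varieties are sets of common zeros in $\mathbb{A}^n$ of polynomials with coefficients in $\mathbb{F}_q$. A point $x$ of the hypersurface $V_f$ is singular if $f$ and all partial derivatives $\partial f/\partial X_j$ vanish at $x$ (equivalently, the tangent space at $x$ has dimension larger than the local dimension). *)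

theory Defs
  imports
    "HOL-Algebra.Algebraic_Closure_Type"
    "HOL-Library.Poly_Mapping"
    "HOL-Library.Cardinality"
    "HOL-Library.Extended_Real"
begin

text \<open>Polynomials over \<open>'q\<close> in variables indexed by the finite type \<open>'n\<close>, as finitely supported
  functions from exponent vectors to coefficients; the ring structure (convolution product) is the
  one of the library.\<close>

type_synonym ('q, 'n) mpol = "('n \<Rightarrow>\<^sub>0 nat) \<Rightarrow>\<^sub>0 'q"

definition Const :: "'q::comm_ring_1 \<Rightarrow> ('q, 'n) mpol" where
  "Const c = Poly_Mapping.single 0 c"

definition Var :: "'n \<Rightarrow> ('q::comm_ring_1, 'n) mpol" where
  "Var i = Poly_Mapping.single (Poly_Mapping.single i 1) 1"

text \<open>When the exponent of \<open>j\<close> is \<open>0\<close> the truncated subtraction is harmless, since the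
  coefficient vanishes.\<close>

definition partial_deriv :: "'n \<Rightarrow> ('q::comm_ring_1, 'n) mpol \<Rightarrow> ('q, 'n) mpol" where
  "partial_deriv j p =
     (\<Sum>e\<in>Poly_Mapping.keys p. Poly_Mapping.single (e - Poly_Mapping.single j 1)
        (of_nat (Poly_Mapping.lookup e j) * Poly_Mapping.lookup p e))"

text \<open>The points of affine \<open>CARD('n)\<close>-space over the algebraic closure of \<open>'q\<close>.\<close>

type_synonym ('q, 'n) affine_point = "'n \<Rightarrow> 'q alg_closure"

definition eval_at :: "('q::field, 'n::finite) mpol \<Rightarrow> ('q, 'n) affine_point \<Rightarrow> 'q alg_closure" where
  "eval_at p x =
     (\<Sum>e\<in>Poly_Mapping.keys p. to_ac (Poly_Mapping.lookup p e) * (\<Prod>i\<in>UNIV. x i ^ Poly_Mapping.lookup e i))"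

definition zero_locus :: "('q::field, 'n::finite) mpol set \<Rightarrow> ('q, 'n) affine_point set" where
  "zero_locus F = {x. \<forall>p\<in>F. eval_at p x = 0}"

definition hypersurface :: "('q::field, 'n::finite) mpol \<Rightarrow> ('q, 'n) affine_point set" where
  "hypersurface f = zero_locus {f}"

definition singular_locus :: "('q::field, 'n::finite) mpol \<Rightarrow> ('q, 'n) affine_point set" where
  "singular_locus f = {x \<in> hypersurface f. \<forall>j. eval_at (partial_deriv j f) x = 0}"

text \<open>Varieties are defined by polynomials with coefficients in \<open>'q\<close> itself, but consist of points
  over the algebraic closure.\<close>

definition variety :: "('q::field, 'n::finite) affine_point set \<Rightarrow> bool" where
  "variety V \<longleftrightarrow> (\<exists>F. V = zero_locus F)"

definition irreducible_variety :: "('q::field, 'n::finite) affine_point set \<Rightarrow> bool" where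
  "irreducible_variety V \<longleftrightarrow> variety V \<and> V \<noteq> {} \<and>
     (\<forall>A B. variety A \<longrightarrow> variety B \<longrightarrow> V = A \<union> B \<longrightarrow> V = A \<or> V = B)"

text \<open>The \<open>ereal\<close> value makes the dimension of the empty set \<open>-\<infinity>\<close>.\<close>

definition variety_dim :: "('q::field, 'n::finite) affine_point set \<Rightarrow> ereal" where
  "variety_dim V = Sup {ereal (real r) | r.
     \<exists>Z. (\<forall>i\<le>r. irreducible_variety (Z i) \<and> Z i \<subseteq> V) \<and> (\<forall>i<r. Z i \<subset> Z (Suc i))}"

end

theory Submission
  imports Defs
begin

text \<open>
  Let \<open>g\<close> be the base of the \<open>k\<close>-th power in \<open>f\<close> and let \<open>Z\<close> be an irreducible variety contained in
  the singular locus. If \<open>g\<close> vanishes on \<open>Z\<close>, then so does every product of all variables but one,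
  hence by irreducibility two of the variables, and \<open>g = 0\<close> makes a third one algebraic over the
  remaining \<open>n - 3\<close>. Otherwise, multiplying the \<open>j\<close>-th partial derivative by \<open>X\<^sub>j\<close> and cancelling
  \<open>g ^ (k - 1)\<close> gives \<open>m k c\<^sub>j X\<^sub>j ^ m = g\<close> on \<open>Z\<close> for all \<open>j\<close>; summing over \<open>j\<close> shows that \<open>g\<close>, and
  so every \<open>X\<^sub>j ^ m\<close>, is constant.

  A chain of irreducible varieties of length \<open>r\<close> ending in \<open>Z\<close> yields \<open>r\<close> polynomials that are
  algebraically independent on \<open>Z\<close>. Comparing the number of functions of bounded degree on \<open>Z\<close>
  with the number of polynomial expressions in these elements bounds \<open>r\<close>.
\<close>

section \<open>Evaluation as a ring homomorphism\<close>

text \<open>Adding a monomial instead of updating a coefficient suits maps that are additive, so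
  that claims about them reduce to monomials.\<close>

lemma poly_mapping_single_induct [case_names zero add_single]:
  fixes p :: "'a \<Rightarrow>\<^sub>0 'b::comm_monoid_add"
  assumes "P 0" and "\<And>p e a. P p \<Longrightarrow> P (p + Poly_Mapping.single e a)"
  shows "P p"
proof (induction p rule: update_induct)
  case (update p e a)
  have "Poly_Mapping.update e a p = p + Poly_Mapping.single e a"
    using update(1)
    by (intro poly_mapping_eqI)
      (auto simp: lookup_update lookup_add lookup_single in_keys_iff when_def)
  with update assms(2) show ?case by simp
qed (fact assms(1))

lemma eval_at_single:
  "eval_at (Poly_Mapping.single e a) x = to_ac a * (\<Prod>i\<in>UNIV. x i ^ Poly_Mapping.lookup e i)"
  by (simp add: eval_at_def)

lemma eval_at_zero [simp]: "eval_at 0 x = 0"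
  by (simp add: eval_at_def)

lemma eval_at_add [simp]: "eval_at (p + q) x = eval_at p x + eval_at q x"
  unfolding eval_at_def by (rule setsum_keys_plus_distrib) (auto simp: algebra_simps)

lemma eval_at_diff [simp]: "eval_at (p - q) x = eval_at p x - eval_at q x"
  using eval_at_add[of "p - q" q x] by (simp del: eval_at_add)

lemma eval_at_mult [simp]: "eval_at (p * q) x = eval_at p x * eval_at q x"
proof (induction p rule: poly_mapping_single_induct)
  case (add_single p e a)
  have "eval_at (Poly_Mapping.single e a * q) x = eval_at (Poly_Mapping.single e a) x * eval_at q x"
    by (induction q rule: poly_mapping_single_induct)
      (auto simp: mult_single eval_at_single lookup_add power_add prod.distrib algebra_simps)
  with add_single show ?case by (simp add: algebra_simps)
qed simp

lemma eval_at_Const [simp]: "eval_at (Const c) x = to_ac c"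
  by (simp add: Const_def eval_at_single)

lemma eval_at_one [simp]: "eval_at 1 x = 1"
  using eval_at_Const[of 1 x] by (simp add: Const_def)

lemma eval_at_Var [simp]: "eval_at (Var i) x = x i"
proof -
  have "x j ^ (1 when i = j) = (if j = i then x i else 1)" for j
    by (auto simp: when_def)
  then show ?thesis
    by (simp add: Var_def eval_at_single lookup_single)
qed

lemma eval_at_power [simp]: "eval_at (p ^ r) x = eval_at p x ^ r"
  by (induction r) simp_all

lemma eval_at_sum [simp]: "eval_at (\<Sum>i\<in>I. p i) x = (\<Sum>i\<in>I. eval_at (p i) x)"
  by (induction I rule: infinite_finite_induct) simp_all

lemma eval_at_prod [simp]: "eval_at (\<Prod>i\<in>I. p i) x = (\<Prod>i\<in>I. eval_at (p i) x)"
  by (induction I rule: infinite_finite_induct) simp_all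

section \<open>Formal partial derivatives\<close>

lemma partial_deriv_single:
  "partial_deriv j (Poly_Mapping.single e a) =
     Poly_Mapping.single (e - Poly_Mapping.single j 1) (of_nat (Poly_Mapping.lookup e j) * a)"
  by (simp add: partial_deriv_def)

lemma partial_deriv_zero [simp]: "partial_deriv j 0 = 0"
  by (simp add: partial_deriv_def)

lemma partial_deriv_add [simp]: "partial_deriv j (p + q) = partial_deriv j p + partial_deriv j q"
  unfolding partial_deriv_def
  by (rule setsum_keys_plus_distrib) (auto simp: algebra_simps single_add)

lemma partial_deriv_diff [simp]: "partial_deriv j (p - q) = partial_deriv j p - partial_deriv j q"
  using partial_deriv_add[of j "p - q" q] by (simp del: partial_deriv_add)

text \<open>Both sides are biadditive, so one induction for each factor reduces the Leibniz rule to
  two monomials.\<close>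

lemma partial_deriv_mult:
  "partial_deriv j (p * q) = partial_deriv j p * q + p * partial_deriv j q"
proof (induction p rule: poly_mapping_single_induct)
  case (add_single p e a)
  \<comment> \<open>The exponents may differ when \<open>j\<close> does not occur in
    \<open>e\<close>, because subtraction is truncated; then the coefficient is zero on both
    sides.\<close>
  have shift: "Poly_Mapping.single (e + d - Poly_Mapping.single j 1) (of_nat (Poly_Mapping.lookup e j) * c)
      = Poly_Mapping.single (e - Poly_Mapping.single j 1 + d) (of_nat (Poly_Mapping.lookup e j) * c)"
    for e d :: "'a \<Rightarrow>\<^sub>0 nat" and c :: 'b
  proof (cases "Poly_Mapping.lookup e j = 0")
    case False
    then have "e + d - Poly_Mapping.single j 1 = e - Poly_Mapping.single j 1 + d"
      by (intro poly_mapping_eqI)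
        (auto simp: lookup_add lookup_minus lookup_single when_def)
    then show ?thesis by simp
  qed simp
  have "partial_deriv j (Poly_Mapping.single e a * q)
      = partial_deriv j (Poly_Mapping.single e a) * q + Poly_Mapping.single e a * partial_deriv j q"
  proof (induction q rule: poly_mapping_single_induct)
    case (add_single q d c)
    have "partial_deriv j (Poly_Mapping.single e a * Poly_Mapping.single d c)
      = partial_deriv j (Poly_Mapping.single e a) * Poly_Mapping.single d c
        + Poly_Mapping.single e a * partial_deriv j (Poly_Mapping.single d c)"
      using shift[of e d "a * c"] shift[of d e "a * c"]
      by (simp add: mult_single partial_deriv_single lookup_add single_add algebra_simps)
    with add_single show ?case by (simp add: algebra_simps)
  qed simp
  with add_single show ?case by (simp add: algebra_simps)
qed simp

lemma partial_deriv_Const [simp]: "partial_deriv j (Const c) = 0"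
  by (simp add: Const_def partial_deriv_single)

lemma partial_deriv_one [simp]: "partial_deriv j 1 = 0"
  using partial_deriv_Const[of j 1] by (simp add: Const_def)

lemma partial_deriv_Var: "partial_deriv j (Var i) = (if i = j then 1 else 0)"
  by (simp add: Var_def partial_deriv_single lookup_single when_def)

lemma partial_deriv_sum: "partial_deriv j (\<Sum>i\<in>I. p i) = (\<Sum>i\<in>I. partial_deriv j (p i))"
  by (induction I rule: infinite_finite_induct) simp_all

lemma partial_deriv_power:
  "partial_deriv j (p ^ r) = of_nat r * p ^ (r - 1) * partial_deriv j p"
proof (induction r)
  case (Suc r)
  then show ?case by (cases r) (simp_all add: partial_deriv_mult algebra_simps)
qed simp

lemma partial_deriv_prod_Var:
  assumes "finite I"
  shows "partial_deriv j (\<Prod>i\<in>I. Var i) = (if j \<in> I then \<Prod>i\<in>I - {j}. Var i else 0)"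
  using assms
proof (induction I rule: finite_induct)
  case (insert i I)
  show ?case
  proof (cases "i = j")
    case True
    with insert show ?thesis by (simp add: partial_deriv_mult partial_deriv_Var)
  next
    case False
    then have "insert i I - {j} = insert i (I - {j})" by auto
    with insert False show ?thesis
      by (auto simp: partial_deriv_mult partial_deriv_Var)
  qed
qed simp

lemma eval_at_of_nat [simp]: "eval_at (of_nat r) x = of_nat r"
  by (induction r) simp_all

section \<open>Primality of the vanishing ideal\<close>

definition vanishes_on :: "('q::field, 'n::finite) mpol \<Rightarrow> ('q, 'n) affine_point set \<Rightarrow> bool" where
  "vanishes_on p Z \<longleftrightarrow> (\<forall>x\<in>Z. eval_at p x = 0)"

text \<open>Adding \<open>p\<close>, respectively \<open>q\<close>, to the equations of
  \<open>Z\<close> gives two varieties that cover \<open>Z\<close>, so one of them is all of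
  \<open>Z\<close>.\<close>

lemma irreducible_variety_vanishes_on_mult:
  assumes "irreducible_variety Z" and "vanishes_on (p * q) Z"
  shows "vanishes_on p Z \<or> vanishes_on q Z"
proof -
  obtain F where F: "Z = zero_locus F"
    using assms(1) by (auto simp: irreducible_variety_def variety_def)
  have "Z = zero_locus (insert p F) \<union> zero_locus (insert q F)"
    using assms(2) by (auto simp: F zero_locus_def vanishes_on_def)
  then have "Z = zero_locus (insert p F) \<or> Z = zero_locus (insert q F)"
    using assms(1) unfolding irreducible_variety_def variety_def by blast
  then show ?thesis by (auto simp: zero_locus_def vanishes_on_def)
qed

text \<open>The vanishing ideal is proper because \<open>Z\<close> has a point; this settles zeroth
  powers and empty products below.\<close>

lemma irreducible_variety_not_vanishes_on_one:
  "irreducible_variety Z \<Longrightarrow> \<not> vanishes_on 1 Z"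
  by (auto simp: irreducible_variety_def vanishes_on_def)

lemma irreducible_variety_vanishes_on_power:
  assumes "irreducible_variety Z" and "vanishes_on (p ^ r) Z"
  shows "vanishes_on p Z"
  using assms(2)
proof (induction r)
  case 0
  with irreducible_variety_not_vanishes_on_one[OF assms(1)] show ?case by simp
next
  case (Suc r)
  with irreducible_variety_vanishes_on_mult[OF assms(1), of p "p ^ r"] show ?case by auto
qed

lemma irreducible_variety_vanishes_on_prod:
  assumes "irreducible_variety Z" and "finite I" and "vanishes_on (\<Prod>i\<in>I. p i) Z"
  shows "\<exists>i\<in>I. vanishes_on (p i) Z"
  using assms(2,3)
proof (induction I rule: finite_induct)
  case empty
  with irreducible_variety_not_vanishes_on_one[OF assms(1)] show ?case by simp
next
  case (insert i I)
  with irreducible_variety_vanishes_on_mult[OF assms(1), of "p i" "\<Prod>i\<in>I. p i"]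
  show ?case by auto
qed

section \<open>Algebraic independence from chains of varieties\<close>

text \<open>Only exponents below the cut-off \<open>N\<close> occur, which keeps the sum finite; independence is
  therefore required for every \<open>N\<close>.\<close>

definition alg_independent_on ::
    "('q::field, 'n::finite) affine_point set \<Rightarrow> nat \<Rightarrow> (nat \<Rightarrow> ('q, 'n) mpol) \<Rightarrow> bool" where
  "alg_independent_on Z r y \<longleftrightarrow>
     (\<forall>N t. vanishes_on (\<Sum>e\<in>{..<r} \<rightarrow>\<^sub>E {..<N}. Const (t e) * (\<Prod>i<r. y i ^ e i)) Z \<longrightarrow>
        (\<forall>e\<in>{..<r} \<rightarrow>\<^sub>E {..<N}. t e = 0))"

text \<open>Dividing a relation on \<open>Z\<close> by the largest possible power of \<open>y r\<close> and restricting to \<open>Y\<close>,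
  where \<open>y r\<close> vanishes, gives a nontrivial relation among the first \<open>r\<close> elements.\<close>

lemma alg_independent_on_Suc:
  fixes Z :: "('q::field, 'n::finite) affine_point set"
  assumes Z: "irreducible_variety Z" and "Y \<subseteq> Z" and indep: "alg_independent_on Y r y"
    and on_Y: "vanishes_on (y r) Y" and not_Z: "\<not> vanishes_on (y r) Z"
  shows "alg_independent_on Z (Suc r) y"
  unfolding alg_independent_on_def
proof (intro allI impI, rule ccontr)
  fix N :: nat and t :: "(nat \<Rightarrow> nat) \<Rightarrow> 'q"
  let ?E = "{..<Suc r} \<rightarrow>\<^sub>E {..<N :: nat}"
  let ?E' = "{..<r} \<rightarrow>\<^sub>E {..<N :: nat}"
  assume rel: "vanishes_on (\<Sum>e\<in>?E. Const (t e) * (\<Prod>i<Suc r. y i ^ e i)) Z"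
    and "\<not> (\<forall>e\<in>?E. t e = 0)"
  then obtain d where "d \<in> ?E \<and> t d \<noteq> 0" by auto
  \<comment> \<open>Among the terms that occur, \<open>e0\<close> has the least power of
    \<open>y r\<close>; this power divides the whole relation.\<close>
  from ex_has_least_nat[of "\<lambda>e. e \<in> ?E \<and> t e \<noteq> 0", OF this, of "\<lambda>e. e r"]
  obtain e0 where e0: "e0 \<in> ?E" "t e0 \<noteq> 0"
    and least: "\<And>e. e \<in> ?E \<Longrightarrow> t e \<noteq> 0 \<Longrightarrow> e0 r \<le> e r"
    by (elim exE conjE) simp
  define s where "s = e0 r"
  \<comment> \<open>The quotient of the relation by \<open>y r ^ s\<close>; \<open>e r - s\<close>
    can be truncated only where \<open>t e = 0\<close>.\<close>
  define q where "q = (\<Sum>e\<in>?E. Const (t e) * (\<Prod>i<r. y i ^ e i) * y r ^ (e r - s))"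
  have "(\<Sum>e\<in>?E. Const (t e) * (\<Prod>i<Suc r. y i ^ e i)) = y r ^ s * q"
    unfolding q_def sum_distrib_left
  proof (rule sum.cong)
    fix e assume e: "e \<in> ?E"
    show "Const (t e) * (\<Prod>i<Suc r. y i ^ e i)
        = y r ^ s * (Const (t e) * (\<Prod>i<r. y i ^ e i) * y r ^ (e r - s))"
    proof (cases "t e = 0")
      case False
      with least[OF e] have "y r ^ e r = y r ^ s * y r ^ (e r - s)"
        by (simp add: s_def flip: power_add)
      then show ?thesis by (simp add: algebra_simps)
    qed (simp add: Const_def)
  qed simp
  with rel have "vanishes_on (y r ^ s * q) Z" by simp
  then have q_Z: "vanishes_on q Z"
    using irreducible_variety_vanishes_on_mult[OF Z] irreducible_variety_vanishes_on_power[OF Z]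
      not_Z by blast
  \<comment> \<open>Nothing is lost by overwriting at \<open>r\<close>, where members of
    \<open>?E'\<close> are \<open>undefined\<close>.\<close>
  have inj: "inj_on (\<lambda>e. e(r := s)) ?E'"
  proof (rule inj_onI)
    fix d e assume d: "d \<in> ?E'" and e: "e \<in> ?E'" and eq: "d(r := s) = e(r := s)"
    have "d r = e r" using PiE_arb[OF d, of r] PiE_arb[OF e, of r] by simp
    with eq show "d = e" by (metis fun_upd_triv fun_upd_upd)
  qed
  have sN: "s < N" using e0(1) by (auto simp: s_def)
  have image: "(\<lambda>e. e(r := s)) ` ?E' = {e \<in> ?E. e r = s}"
  proof (intro equalityI subsetI)
    fix e assume e: "e \<in> {e \<in> ?E. e r = s}"
    then have "e(r := undefined) \<in> ?E'" "e = (e(r := undefined))(r := s)"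
      by (auto simp: PiE_def extensional_def Pi_def)
    then show "e \<in> (\<lambda>e. e(r := s)) ` ?E'" by blast
  next
    fix e assume "e \<in> (\<lambda>e. e(r := s)) ` ?E'"
    then show "e \<in> {e \<in> ?E. e r = s}" using sN by (auto simp: PiE_def extensional_def Pi_def)
  qed
  have "vanishes_on (\<Sum>e\<in>?E'. Const (t (e(r := s))) * (\<Prod>i<r. y i ^ e i)) Y"
    unfolding vanishes_on_def
  proof
    fix x assume x: "x \<in> Y"
    have "0 = eval_at q x" using q_Z x \<open>Y \<subseteq> Z\<close> by (auto simp: vanishes_on_def)
    also have "\<dots> = (\<Sum>e\<in>?E. to_ac (t e) * (\<Prod>i<r. eval_at (y i) x ^ e i)
        * eval_at (y r) x ^ (e r - s))"
      by (simp add: q_def)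
    \<comment> \<open>Since \<open>y r\<close> is zero on \<open>Y\<close>, only zeroth powers of it
      survive.\<close>
    also have "\<dots> = (\<Sum>e\<in>{e \<in> ?E. e r = s}. to_ac (t e) * (\<Prod>i<r. eval_at (y i) x ^ e i))"
    proof (rule sum.mono_neutral_cong_right)
      have zero: "eval_at (y r) x = 0" using on_Y x by (simp add: vanishes_on_def)
      show "\<forall>e\<in>?E - {e \<in> ?E. e r = s}. to_ac (t e) * (\<Prod>i<r. eval_at (y i) x ^ e i)
          * eval_at (y r) x ^ (e r - s) = 0"
      proof
        fix e assume e: "e \<in> ?E - {e \<in> ?E. e r = s}"
        show "to_ac (t e) * (\<Prod>i<r. eval_at (y i) x ^ e i) * eval_at (y r) x ^ (e r - s) = 0"
          using least[of e] e by (cases "t e = 0") (auto simp: zero s_def power_0_left)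
      qed
    qed (auto intro!: finite_PiE)
    also have "\<dots> = (\<Sum>e\<in>?E'. to_ac (t (e(r := s))) * (\<Prod>i<r. eval_at (y i) x ^ e i))"
      unfolding image[symmetric] sum.reindex[OF inj] by (intro sum.cong) (auto intro!: prod.cong)
    finally show "eval_at (\<Sum>e\<in>?E'. Const (t (e(r := s))) * (\<Prod>i<r. y i ^ e i)) x = 0"
      by simp
  qed
  then have "\<forall>e\<in>?E'. t (e(r := s)) = 0"
    using indep unfolding alg_independent_on_def
    by (elim allE[of _ N] allE[of _ "\<lambda>e. t (e(r := s))"]) blast
  moreover have "e0 \<in> (\<lambda>e. e(r := s)) ` ?E'"
    unfolding image using e0(1) by (simp add: s_def)
  ultimately show False using e0(2) by auto
qed

text \<open>Each strict inclusion supplies a polynomial that vanishes on the smaller variety but not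
  on the larger; climbing the chain adds one independent element per step.\<close>

lemma irreducible_chain_alg_independent:
  fixes Z :: "nat \<Rightarrow> ('q::field, 'n::finite) affine_point set"
  assumes irr: "\<And>i. i \<le> r \<Longrightarrow> irreducible_variety (Z i)"
    and chain: "\<And>i. i < r \<Longrightarrow> Z i \<subset> Z (Suc i)"
  shows "\<exists>y. alg_independent_on (Z r) r y"
proof -
  have "\<exists>p. vanishes_on p (Z i) \<and> \<not> vanishes_on p (Z (Suc i))" if i: "i < r" for i
  proof -
    obtain F where F: "Z i = zero_locus F"
      using irr[of i] i by (auto simp: irreducible_variety_def variety_def)
    obtain x where x: "x \<in> Z (Suc i)" "x \<notin> Z i" using chain[OF i] by blast
    then obtain p where "p \<in> F" "eval_at p x \<noteq> 0" by (auto simp: F zero_locus_def)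
    with x(1) show ?thesis by (intro exI[of _ p]) (auto simp: F zero_locus_def vanishes_on_def)
  qed
  then obtain y where y: "\<And>i. i < r \<Longrightarrow> vanishes_on (y i) (Z i) \<and> \<not> vanishes_on (y i) (Z (Suc i))"
    by metis
  have "alg_independent_on (Z i) i y" if "i \<le> r" for i
    using that
  proof (induction i)
    case 0
    \<comment> \<open>A relation among no elements is a single constant, and one point of
      \<open>Z 0\<close> forces it to be zero.\<close>
    obtain x where "x \<in> Z 0" using irr[of 0] by (auto simp: irreducible_variety_def)
    then show ?case by (auto simp: alg_independent_on_def vanishes_on_def)
  next
    case (Suc i)
    with y[of i] chain[of i] irr[of "Suc i"] show ?case
      by (intro alg_independent_on_Suc[of "Z (Suc i)" "Z i"]) auto
  qed
  then show ?thesis by blast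
qed

section \<open>Normal forms and counting functions by degree\<close>

text \<open>On \<open>Z\<close> the \<open>m\<close>-th powers of the variables outside \<open>S\<close> are combinations of \<open>m\<close>-th powers of
  the variables in \<open>S\<close>. Substituting them does not raise the total degree, so functions of degree at
  most \<open>d\<close> on \<open>Z\<close> are spanned by \<open>O(d ^ card S)\<close> monomials.\<close>

locale power_reduction =
  fixes Z :: "('q::{field, finite}, 'n::finite) affine_point set"
    and S :: "'n set" and m :: nat and u :: "'n \<Rightarrow> 'q" and v :: "'n \<Rightarrow> 'n \<Rightarrow> 'q"
  assumes m_pos: "m > 0"
    and reduce: "\<And>l x. l \<notin> S \<Longrightarrow> x \<in> Z \<Longrightarrow>
      x l ^ m = to_ac (u l) + (\<Sum>s\<in>S. to_ac (v l s) * x s ^ m)"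
begin

definition reduced_exps :: "nat \<Rightarrow> ('n \<Rightarrow> nat) set" where
  "reduced_exps d = {e. (\<Sum>i\<in>UNIV. e i) \<le> d \<and> (\<forall>l. l \<notin> S \<longrightarrow> e l < m)}"

text \<open>Coefficients are taken from the finite field, not its closure, so that there are
  finitely many normal forms to count. Uniqueness of the normal form is not claimed.\<close>

definition reducible :: "nat \<Rightarrow> (('q, 'n) affine_point \<Rightarrow> 'q alg_closure) \<Rightarrow> bool" where
  "reducible d \<phi> \<longleftrightarrow>
     (\<exists>t. \<forall>x\<in>Z. \<phi> x = (\<Sum>e\<in>reduced_exps d. to_ac (t e) * (\<Prod>i\<in>UNIV. x i ^ e i)))"

lemma reduced_exps_subset:
  "reduced_exps d \<subseteq> (\<Pi>\<^sub>E i\<in>UNIV. if i \<in> S then {..d} else {..<m})"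
proof
  fix e assume e: "e \<in> reduced_exps d"
  have "e i \<le> d" for i
    using e member_le_sum[of i UNIV e] by (auto simp: reduced_exps_def)
  with e show "e \<in> (\<Pi>\<^sub>E i\<in>UNIV. if i \<in> S then {..d} else {..<m})"
    by (auto simp: reduced_exps_def)
qed

lemma finite_reduced_exps [simp]: "finite (reduced_exps d)"
  by (rule finite_subset[OF reduced_exps_subset]) (auto intro: finite_PiE)

lemma card_reduced_exps_le:
  "card (reduced_exps d) \<le> (d + 1) ^ card S * m ^ card (- S)"
proof -
  have "card (reduced_exps d) \<le> card (\<Pi>\<^sub>E i\<in>(UNIV :: 'n set). if i \<in> S then {..d} else {..<m})"
    by (rule card_mono[OF _ reduced_exps_subset]) (auto intro: finite_PiE)
  also have "\<dots> = (\<Prod>i\<in>UNIV. if i \<in> S then d + 1 else m)"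
    by (simp add: card_PiE if_distrib cong: if_cong)
  also have "\<dots> = (d + 1) ^ card S * m ^ card (- S)"
    by (simp add: prod.If_cases)
  finally show ?thesis .
qed

lemma reducible_cong: "reducible d \<phi> \<Longrightarrow> (\<And>x. x \<in> Z \<Longrightarrow> \<psi> x = \<phi> x) \<Longrightarrow> reducible d \<psi>"
  by (auto simp: reducible_def)

lemma reducible_zero: "reducible d (\<lambda>x. 0)"
  unfolding reducible_def by (intro exI[of _ "\<lambda>_. 0"]) simp

lemma reducible_add:
  assumes "reducible d \<phi>" and "reducible d \<psi>"
  shows "reducible d (\<lambda>x. \<phi> x + \<psi> x)"
proof -
  from assms obtain t t' where
    "\<forall>x\<in>Z. \<phi> x = (\<Sum>e\<in>reduced_exps d. to_ac (t e) * (\<Prod>i\<in>UNIV. x i ^ e i))"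
    "\<forall>x\<in>Z. \<psi> x = (\<Sum>e\<in>reduced_exps d. to_ac (t' e) * (\<Prod>i\<in>UNIV. x i ^ e i))"
    unfolding reducible_def by blast
  then show ?thesis unfolding reducible_def
    by (intro exI[of _ "\<lambda>e. t e + t' e"]) (simp add: distrib_right sum.distrib)
qed

lemma reducible_scale:
  assumes "reducible d \<phi>"
  shows "reducible d (\<lambda>x. to_ac c * \<phi> x)"
proof -
  from assms obtain t where
    "\<forall>x\<in>Z. \<phi> x = (\<Sum>e\<in>reduced_exps d. to_ac (t e) * (\<Prod>i\<in>UNIV. x i ^ e i))"
    unfolding reducible_def by blast
  then show ?thesis unfolding reducible_def
    by (intro exI[of _ "\<lambda>e. c * t e"]) (simp add: sum_distrib_left mult.assoc)
qed

lemma reducible_sum: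
  "(\<And>i. i \<in> I \<Longrightarrow> reducible d (\<phi> i)) \<Longrightarrow> reducible d (\<lambda>x. \<Sum>i\<in>I. \<phi> i x)"
  by (induction I rule: infinite_finite_induct) (simp_all add: reducible_zero reducible_add)

text \<open>Rewriting a factor \<open>x l ^ m\<close> with \<open>l\<close> outside \<open>S\<close>
  either drops \<open>m\<close> units of degree or moves them into \<open>S\<close>. The degree
  outside \<open>S\<close> falls, and the total degree does not rise.\<close>

lemma reducible_monomial:
  "(\<Sum>i\<in>UNIV. e i) \<le> d \<Longrightarrow> reducible d (\<lambda>x. \<Prod>i\<in>UNIV. x i ^ e i)"
proof (induction "\<Sum>i\<in>-S. e i" arbitrary: e rule: less_induct)
  case less
  show ?case
  proof (cases "\<exists>l. l \<notin> S \<and> m \<le> e l")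
    case False
    with less.prems have e: "e \<in> reduced_exps d" by (auto simp: reduced_exps_def not_le)
    have "(\<Sum>e'\<in>reduced_exps d. to_ac (if e' = e then 1 else 0) * (\<Prod>i\<in>UNIV. x i ^ e' i))
        = (\<Prod>i\<in>UNIV. x i ^ e i)" for x :: "'n \<Rightarrow> 'q alg_closure"
      using e by (simp add: if_distrib[of to_ac] if_distrib[of "\<lambda>z. z * _"] cong: if_cong)
    then show ?thesis unfolding reducible_def
      by (intro exI[of _ "\<lambda>e'. if e' = e then 1 else 0"]) simp
  next
    case True
    then obtain l where l: "l \<notin> S" "m \<le> e l" by blast
    \<comment> \<open>The cofactor of \<open>x l ^ m\<close>; the rewritten terms are this monomial
      itself and its multiples by \<open>x s ^ m\<close> with \<open>s\<close> in
      \<open>S\<close>.\<close>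
    define e0 where "e0 = e(l := e l - m)"
    have e: "e = e0(l := e0 l + m)" using l(2) by (auto simp: e0_def)
    have sum_upd: "(\<Sum>i\<in>A. (e0(s := e0 s + m)) i) = (\<Sum>i\<in>A. e0 i) + (if s \<in> A then m else 0)"
      for s A
    proof -
      have "(\<Sum>i\<in>A. (e0(s := e0 s + m)) i) = (\<Sum>i\<in>A. e0 i + (if s = i then m else 0))"
        by (intro sum.cong) auto
      then show ?thesis by (simp add: sum.distrib)
    qed
    have prod_upd: "(\<Prod>i\<in>UNIV. x i ^ (e0(s := e0 s + m)) i) = x s ^ m * (\<Prod>i\<in>UNIV. x i ^ e0 i)"
      for s and x :: "'n \<Rightarrow> 'q alg_closure"
    proof -
      have "(\<Prod>i\<in>UNIV. x i ^ (e0(s := e0 s + m)) i)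
          = (\<Prod>i\<in>UNIV. x i ^ e0 i * (if s = i then x i ^ m else 1))"
        by (intro prod.cong) (auto simp: power_add)
      then show ?thesis by (simp add: prod.distrib)
    qed
    have lower: "(\<Sum>i\<in>-S. e i) = (\<Sum>i\<in>-S. e0 i) + m" and total: "(\<Sum>i\<in>UNIV. e0 i) + m \<le> d"
      using sum_upd[of l "-S"] sum_upd[of l UNIV] less.prems l(1) e by auto
    have "reducible d (\<lambda>x. \<Prod>i\<in>UNIV. x i ^ e0 i)"
      using less.hyps[of e0] lower total m_pos by simp
    moreover have "reducible d (\<lambda>x. \<Prod>i\<in>UNIV. x i ^ (e0(s := e0 s + m)) i)" if "s \<in> S" for s
      using less.hyps[of "e0(s := e0 s + m)"] lower total m_pos sum_upd[of s "-S"]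
        sum_upd[of s UNIV] that by simp
    ultimately have "reducible d (\<lambda>x. to_ac (u l) * (\<Prod>i\<in>UNIV. x i ^ e0 i)
        + (\<Sum>s\<in>S. to_ac (v l s) * (\<Prod>i\<in>UNIV. x i ^ (e0(s := e0 s + m)) i)))"
      by (intro reducible_add reducible_scale reducible_sum) auto
    then show ?thesis
    proof (rule reducible_cong)
      fix x assume x: "x \<in> Z"
      have "(\<Prod>i\<in>UNIV. x i ^ e i) = x l ^ m * (\<Prod>i\<in>UNIV. x i ^ e0 i)"
        using prod_upd[of x l] e by simp
      then show "(\<Prod>i\<in>UNIV. x i ^ e i) = to_ac (u l) * (\<Prod>i\<in>UNIV. x i ^ e0 i)
        + (\<Sum>s\<in>S. to_ac (v l s) * (\<Prod>i\<in>UNIV. x i ^ (e0(s := e0 s + m)) i))"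
        unfolding prod_upd reduce[OF l(1) x]
        by (simp add: distrib_right sum_distrib_right mult.assoc)
    qed
  qed
qed

lemma reducible_mult:
  assumes "reducible d \<phi>" and "reducible d' \<psi>"
  shows "reducible (d + d') (\<lambda>x. \<phi> x * \<psi> x)"
proof -
  from assms obtain t t' where t:
    "\<forall>x\<in>Z. \<phi> x = (\<Sum>e\<in>reduced_exps d. to_ac (t e) * (\<Prod>i\<in>UNIV. x i ^ e i))"
    "\<forall>x\<in>Z. \<psi> x = (\<Sum>e\<in>reduced_exps d'. to_ac (t' e) * (\<Prod>i\<in>UNIV. x i ^ e i))"
    unfolding reducible_def by blast
  have "reducible (d + d') (\<lambda>x. \<Sum>e\<in>reduced_exps d. \<Sum>e'\<in>reduced_exps d'.
      to_ac (t e * t' e') * (\<Prod>i\<in>UNIV. x i ^ (e i + e' i)))"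
    by (intro reducible_sum reducible_scale reducible_monomial)
      (auto simp: reduced_exps_def sum.distrib)
  then show ?thesis
    by (rule reducible_cong)
      (simp add: t sum_product power_add prod.distrib mult.assoc mult.left_commute)
qed

text \<open>Multiply by the constant 1, regarded as a function of degree at most
  \<open>d' - d\<close>.\<close>

lemma reducible_mono:
  assumes "reducible d \<phi>" and "d \<le> d'"
  shows "reducible d' \<phi>"
proof -
  have "reducible (d' - d) (\<lambda>x. 1)"
    using reducible_monomial[of "\<lambda>_. 0"] by simp
  from reducible_mult[OF assms(1) this] assms(2) show ?thesis by simp
qed

lemma reducible_power: "reducible d \<phi> \<Longrightarrow> reducible (r * d) (\<lambda>x. \<phi> x ^ r)"
proof (induction r)
  case 0
  then show ?case using reducible_monomial[of "\<lambda>_. 0"] by simp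
next
  case (Suc r)
  then show ?case using reducible_mult[of d \<phi> "r * d"] by simp
qed

lemma reducible_prod:
  "(\<And>i. i < r \<Longrightarrow> reducible d (\<phi> i)) \<Longrightarrow> reducible (r * d) (\<lambda>x. \<Prod>i<r. \<phi> i x)"
proof (induction r)
  case 0
  then show ?case using reducible_monomial[of "\<lambda>_. 0"] by simp
next
  case (Suc r)
  then show ?case using reducible_mult[of "r * d" _ d "\<phi> r"] by (simp add: add.commute)
qed

lemma reducible_eval_at: "\<exists>d. reducible d (eval_at p)"
proof (induction p rule: poly_mapping_single_induct)
  case zero
  show ?case by (simp add: reducible_zero)
next
  case (add_single p e a)
  then obtain d where "reducible d (eval_at p)" by blast
  moreover define d' where "d' = (\<Sum>i\<in>UNIV. Poly_Mapping.lookup e i)"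
  ultimately have "reducible (d + d') (\<lambda>x. eval_at p x
      + to_ac a * (\<Prod>i\<in>UNIV. x i ^ Poly_Mapping.lookup e i))"
    by (intro reducible_add reducible_scale reducible_monomial) (auto intro: reducible_mono)
  then show ?case by (auto simp: eval_at_single intro!: exI[of _ "d + d'"] elim: reducible_cong)
qed

text \<open>The \<open>q ^ (N ^ r)\<close> polynomials in \<open>y\<close> with exponents below \<open>N\<close> are distinct functions on \<open>Z\<close>,
  all of degree \<open>O(N)\<close>.\<close>

lemma alg_independent_on_card_le:
  assumes indep: "alg_independent_on Z r y"
  shows "r \<le> card S"
proof (rule ccontr)
  assume "\<not> r \<le> card S"
  then have r: "card S < r" by simp
  have "\<forall>i. \<exists>d. reducible d (eval_at (y i))" using reducible_eval_at by blast
  from choice[OF this] obtain d where d: "\<And>i. reducible (d i) (eval_at (y i))" by blast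
  define D where "D = (\<Sum>i<r. d i)"
  have D: "reducible D (eval_at (y i))" if "i < r" for i
    using reducible_mono[OF d[of i]] that member_le_sum[of i "{..<r}" d] by (auto simp: D_def)
  have bound: "N ^ r \<le> (r * (N * D) + 1) ^ card S * m ^ card (- S)" for N
  proof -
    let ?E = "{..<r} \<rightarrow>\<^sub>E {..<N}"
    let ?R = "reduced_exps (r * (N * D))"
    have "\<forall>e\<in>?E. \<exists>\<tau>. \<forall>x\<in>Z. (\<Prod>i<r. eval_at (y i) x ^ e i)
        = (\<Sum>e'\<in>?R. to_ac (\<tau> e') * (\<Prod>i\<in>UNIV. x i ^ e' i))"
    proof
      fix e assume e: "e \<in> ?E"
      have "reducible (N * D) (\<lambda>x. eval_at (y i) x ^ e i)" if "i < r" for i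
      proof (rule reducible_mono[OF reducible_power[OF D[OF that], of "e i"]])
        show "e i * D \<le> N * D" using e that by (intro mult_right_mono) (auto intro: less_imp_le)
      qed
      from reducible_prod[OF this]
      show "\<exists>\<tau>. \<forall>x\<in>Z. (\<Prod>i<r. eval_at (y i) x ^ e i)
        = (\<Sum>e'\<in>?R. to_ac (\<tau> e') * (\<Prod>i\<in>UNIV. x i ^ e' i))"
        by (simp add: reducible_def)
    qed
    from bchoice[OF this] obtain \<tau> where \<tau>: "\<And>e x. e \<in> ?E \<Longrightarrow> x \<in> Z \<Longrightarrow> (\<Prod>i<r. eval_at (y i) x ^ e i)
        = (\<Sum>e'\<in>?R. to_ac (\<tau> e e') * (\<Prod>i\<in>UNIV. x i ^ e' i))"
      by (elim exE) simp
    \<comment> \<open>With one normal form \<open>\<tau> e\<close> fixed for each monomial in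
      \<open>y\<close>, this linear map takes the coefficients of an expression in \<open>y\<close>
      to those of a normal form. Independence makes it injective.\<close>
    define \<Phi> where "\<Phi> t = (\<lambda>e'\<in>?R. \<Sum>e\<in>?E. t e * \<tau> e e')" for t :: "(nat \<Rightarrow> nat) \<Rightarrow> 'q"
    have \<Phi>: "(\<Sum>e\<in>?E. to_ac (t e) * (\<Prod>i<r. eval_at (y i) x ^ e i))
        = (\<Sum>e'\<in>?R. to_ac (\<Phi> t e') * (\<Prod>i\<in>UNIV. x i ^ e' i))" if "x \<in> Z" for t x
    proof -
      have "(\<Sum>e\<in>?E. to_ac (t e) * (\<Prod>i<r. eval_at (y i) x ^ e i))
          = (\<Sum>e\<in>?E. \<Sum>e'\<in>?R. to_ac (t e * \<tau> e e') * (\<Prod>i\<in>UNIV. x i ^ e' i))"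
        using that by (intro sum.cong) (simp_all add: \<tau> sum_distrib_left mult.assoc)
      also have "\<dots> = (\<Sum>e'\<in>?R. \<Sum>e\<in>?E. to_ac (t e * \<tau> e e') * (\<Prod>i\<in>UNIV. x i ^ e' i))"
        by (rule sum.swap)
      also have "\<dots> = (\<Sum>e'\<in>?R. to_ac (\<Phi> t e') * (\<Prod>i\<in>UNIV. x i ^ e' i))"
        by (intro sum.cong) (simp_all add: \<Phi>_def to_ac_sum sum_distrib_right)
      finally show ?thesis .
    qed
    have "inj_on \<Phi> (?E \<rightarrow>\<^sub>E UNIV)"
    proof (rule inj_onI)
      fix t t' assume t: "t \<in> ?E \<rightarrow>\<^sub>E UNIV" and t': "t' \<in> ?E \<rightarrow>\<^sub>E UNIV" and eq: "\<Phi> t = \<Phi> t'"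
      have "vanishes_on (\<Sum>e\<in>?E. Const (t e - t' e) * (\<Prod>i<r. y i ^ e i)) Z"
        using \<Phi>[of _ t] \<Phi>[of _ t'] eq
        by (simp add: vanishes_on_def left_diff_distrib sum_subtractf)
      then have "\<forall>e\<in>?E. t e - t' e = 0"
        using indep unfolding alg_independent_on_def
        by (elim allE[of _ N] allE[of _ "\<lambda>e. t e - t' e"]) blast
      then show "t = t'" by (intro PiE_ext[OF t t']) auto
    qed
    moreover have "\<Phi> ` (?E \<rightarrow>\<^sub>E UNIV) \<subseteq> ?R \<rightarrow>\<^sub>E UNIV"
      by (auto simp: \<Phi>_def)
    ultimately have "card (?E \<rightarrow>\<^sub>E (UNIV :: 'q set)) \<le> card (?R \<rightarrow>\<^sub>E (UNIV :: 'q set))"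
      by (rule card_inj_on_le) (auto intro: finite_PiE)
    then have "CARD('q) ^ (N ^ r) \<le> CARD('q) ^ card ?R"
      by (simp add: card_PiE finite_PiE)
    moreover have "1 < CARD('q)"
      using card_mono[of "UNIV :: 'q set" "{0, 1}"] by simp
    ultimately have "N ^ r \<le> card ?R" by (simp add: power_increasing_iff)
    then show ?thesis using card_reduced_exps_le by (rule order_trans)
  qed
  \<comment> \<open>As \<open>r * (N * D) + 1 \<le> N * (r * D + 1)\<close> for positive
    \<open>N\<close>, the bound yields \<open>N ^ (r - card S) \<le> C\<close>, which fails for
    \<open>N = C + 1\<close> because the exponent is positive.\<close>
  define C where "C = (r * D + 1) ^ card S * m ^ card (- S)"
  define N where "N = C + 1"
  have "N ^ card S * N ^ (r - card S) = N ^ r"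
    using r by (simp flip: power_add)
  also have "\<dots> \<le> (r * (N * D) + 1) ^ card S * m ^ card (- S)" by (rule bound)
  also have "\<dots> \<le> (N * (r * D + 1)) ^ card S * m ^ card (- S)"
    by (intro mult_right_mono power_mono) (simp_all add: N_def algebra_simps)
  also have "\<dots> = N ^ card S * C" by (simp only: C_def power_mult_distrib mult.assoc)
  finally have "N ^ (r - card S) \<le> C" by (simp add: N_def)
  moreover have "N ^ 1 \<le> N ^ (r - card S)"
    using r by (intro power_increasing) (auto simp: N_def)
  ultimately show False by (simp add: N_def)
qed

end

section \<open>Equations on irreducible subvarieties of the singular locus\<close>

text \<open>The set \<open>S\<close> depends on \<open>Z\<close>: it omits three variables if the
  base of the \<open>k\<close>-th power vanishes on \<open>Z\<close>, and is empty
  otherwise.\<close>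

lemma singular_locus_irreducible_power_reduction:
  fixes a b :: "'q::{field, finite}"
    and c :: "'n::finite \<Rightarrow> 'q"
    and f :: "('q, 'n) mpol"
  assumes n: "CARD('n) \<ge> 3" and m: "m \<ge> 2" and k: "k \<ge> 2"
    and char: "\<not> CHAR('q) dvd m * k"
    and a: "a \<noteq> 0" and b: "b \<noteq> 0" and c: "\<And>i. c i \<noteq> 0"
    and f: "f = ((\<Sum>i\<in>UNIV. Const (c i) * Var i ^ m) + Const a) ^ k - Const b * (\<Prod>i\<in>UNIV. Var i)"
    and irr: "irreducible_variety Z" and sing: "Z \<subseteq> singular_locus f"
  shows "\<exists>S u v. card S \<le> CARD('n) - 3 \<and> power_reduction Z S m u v"
proof -
  define g :: "('q, 'n) mpol" where "g = (\<Sum>i\<in>UNIV. Const (c i) * Var i ^ m) + Const a"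
  have g: "eval_at g x = (\<Sum>i\<in>UNIV. to_ac (c i) * x i ^ m) + to_ac a" for x
    by (simp add: g_def)
  have f_zero: "eval_at g x ^ k = to_ac b * (\<Prod>i\<in>UNIV. x i)" if "x \<in> Z" for x
    using that sing unfolding singular_locus_def hypersurface_def zero_locus_def f g_def[symmetric]
    by auto
  have dg: "partial_deriv j g = Const (c j) * (of_nat m * Var j ^ (m - 1))" for j
    by (simp add: g_def partial_deriv_sum partial_deriv_mult partial_deriv_power partial_deriv_Var
        if_distrib[of "\<lambda>z. _ * z"] cong: if_cong)
  have df: "partial_deriv j f = of_nat k * g ^ (k - 1) * (Const (c j) * (of_nat m * Var j ^ (m - 1)))
      - Const b * (\<Prod>i\<in>UNIV - {j}. Var i)" for j
    unfolding f g_def[symmetric]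
    by (simp add: partial_deriv_power partial_deriv_mult partial_deriv_prod_Var dg)
  have df_zero: "of_nat k * eval_at g x ^ (k - 1) * (to_ac (c j) * (of_nat m * x j ^ (m - 1)))
      = to_ac b * (\<Prod>i\<in>UNIV - {j}. x i)" if "x \<in> Z" for x j
  proof -
    have "eval_at (partial_deriv j f) x = 0" using that sing by (auto simp: singular_locus_def)
    then show ?thesis by (simp add: df)
  qed
  show ?thesis
  proof (cases "vanishes_on g Z")
    case True
    then have g0: "eval_at g x = 0" if "x \<in> Z" for x using that by (simp add: vanishes_on_def)
    have "\<exists>i\<in>UNIV - {j}. vanishes_on (Var i) Z" for j
    proof (rule irreducible_variety_vanishes_on_prod[OF irr])
      show "vanishes_on (\<Prod>i\<in>UNIV - {j}. Var i) Z"
        using df_zero[of _ j] g0 k b by (auto simp: vanishes_on_def power_0_left)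
    qed simp
    \<comment> \<open>Omitting an arbitrary variable yields one that vanishes; omitting that one
      yields a second.\<close>
    then obtain i j where ij: "i \<noteq> j" "vanishes_on (Var i) Z" "vanishes_on (Var j) Z"
      by (metis DiffE insertI1)
    have "card {i, j} < CARD('n)" using ij(1) n by simp
    then obtain l where l: "l \<notin> {i, j}"
      by (metis UNIV_eq_I nat_neq_iff)
    define S where "S = UNIV - {i, j, l}"
    have "card {i, j, l} = 3" using ij(1) l by auto
    then have card_S: "card S = CARD('n) - 3" by (simp add: S_def card_Diff_subset)
    have zero: "x i = 0" "x j = 0" if "x \<in> Z" for x
      using ij that by (auto simp: vanishes_on_def)
    \<comment> \<open>The coefficients at \<open>l\<close> come from solving \<open>g = 0\<close>
      for its \<open>m\<close>-th power; the other two variables outside \<open>S\<close> are zero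
      on \<open>Z\<close>.\<close>
    have "power_reduction Z S m (\<lambda>s. if s = l then - a / c l else 0)
        (\<lambda>s s'. if s = l then - c s' / c l else 0)"
    proof
      show "m > 0" using m by simp
      fix s x assume s: "s \<notin> S" and x: "x \<in> Z"
      have "UNIV = insert i (insert j (insert l S))" by (auto simp: S_def)
      then have "(\<Sum>i\<in>UNIV. to_ac (c i) * x i ^ m)
          = (\<Sum>i\<in>insert i (insert j (insert l S)). to_ac (c i) * x i ^ m)" by simp
      also have "\<dots> = to_ac (c l) * x l ^ m + (\<Sum>i\<in>S. to_ac (c i) * x i ^ m)"
      proof -
        have "i \<notin> insert j (insert l S)" "j \<notin> insert l S" "l \<notin> S"
          using ij(1) l by (auto simp: S_def)
        then show ?thesis using m zero[OF x] by (simp add: power_0_left)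
      qed
      finally have "to_ac (c l) * x l ^ m = - to_ac a - (\<Sum>i\<in>S. to_ac (c i) * x i ^ m)"
        using g0[OF x] by (simp add: g algebra_simps eq_neg_iff_add_eq_0)
      then have "x l ^ m = (- to_ac a - (\<Sum>i\<in>S. to_ac (c i) * x i ^ m)) / to_ac (c l)"
        using c[of l] by (simp add: field_simps)
      then have "x l ^ m = to_ac (- a / c l) + (\<Sum>s'\<in>S. to_ac (- c s' / c l) * x s' ^ m)"
        by (simp add: diff_divide_distrib sum_divide_distrib sum_negf)
      moreover have "s \<in> {i, j, l}" using s by (auto simp: S_def)
      ultimately show "x s ^ m = to_ac (if s = l then - a / c l else 0)
          + (\<Sum>s'\<in>S. to_ac (if s = l then - c s' / c l else 0) * x s' ^ m)"
        using m zero[OF x] l by (auto simp: power_0_left)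
    qed
    with card_S show ?thesis by (intro exI conjI) auto
  next
    case False
    have eq: "of_nat (m * k) * to_ac (c j) * x j ^ m = eval_at g x" if x: "x \<in> Z" for x j
    proof -
      \<comment> \<open>This is \<open>Var j\<close> times the \<open>j\<close>-th derivative, with
        the product of all variables replaced through \<open>f = 0\<close>.\<close>
      have "vanishes_on (g ^ (k - 1) * (Const (of_nat (m * k) * c j) * Var j ^ m - g)) Z"
        unfolding vanishes_on_def
      proof
        fix x assume x: "x \<in> Z"
        have "x j ^ m = x j ^ (m - 1) * x j" using m by (simp flip: power_Suc2)
        moreover have "eval_at g x ^ k = eval_at g x ^ (k - 1) * eval_at g x"
          using k by (simp flip: power_Suc2)
        moreover have "(\<Prod>i\<in>UNIV. x i) = (\<Prod>i\<in>UNIV - {j}. x i) * x j"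
          by (simp add: prod.remove[of UNIV j] mult.commute)
        moreover have "of_nat k * eval_at g x ^ (k - 1) * (to_ac (c j) * (of_nat m * x j ^ (m - 1))) * x j
            = to_ac b * ((\<Prod>i\<in>UNIV - {j}. x i) * x j)"
          using df_zero[OF x, of j] by simp
        ultimately show "eval_at (g ^ (k - 1) * (Const (of_nat (m * k) * c j) * Var j ^ m - g)) x = 0"
          using f_zero[OF x] by (simp add: algebra_simps)
      qed
      then have "vanishes_on (Const (of_nat (m * k) * c j) * Var j ^ m - g) Z"
        using irreducible_variety_vanishes_on_mult[OF irr]
          irreducible_variety_vanishes_on_power[OF irr] False by blast
      with x show ?thesis by (simp add: vanishes_on_def)
    qed
    define M :: 'q where "M = of_nat (m * k)"
    have M: "M \<noteq> 0" using char unfolding M_def of_nat_eq_0_iff_char_dvd .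
    have sum_eq: "to_ac (M - of_nat CARD('n)) * eval_at g x = to_ac (M * a)" if x: "x \<in> Z" for x
    proof -
      have "of_nat CARD('n) * eval_at g x = (\<Sum>j\<in>(UNIV :: 'n set). eval_at g x)" by simp
      also have "\<dots> = (\<Sum>j\<in>UNIV. to_ac M * (to_ac (c j) * x j ^ m))"
        using eq[OF x] by (simp add: M_def mult.assoc)
      also have "\<dots> = to_ac M * (eval_at g x - to_ac a)"
        by (simp add: g flip: sum_distrib_left)
      finally show ?thesis by (simp add: algebra_simps)
    qed
    obtain x0 where x0: "x0 \<in> Z" using irr by (auto simp: irreducible_variety_def)
    \<comment> \<open>Otherwise the summed equation at a point of \<open>Z\<close> reads
      \<open>0 = M * a\<close>, although both factors are nonzero.\<close>
    have nz: "M - of_nat CARD('n) \<noteq> 0"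
    proof
      assume "M - of_nat CARD('n) = 0"
      with sum_eq[OF x0] have "to_ac (M * a) = 0" by (simp only: to_ac_0 mult_zero_left)
      with M a show False by simp
    qed
    define w where "w = M * a / (M - of_nat CARD('n))"
    have "to_ac (M - of_nat CARD('n)) * eval_at g x = to_ac (M - of_nat CARD('n)) * to_ac w"
      if "x \<in> Z" for x
      unfolding sum_eq[OF that] to_ac_mult[symmetric] using nz by (simp add: w_def)
    then have w: "eval_at g x = to_ac w" if "x \<in> Z" for x
      using that nz by (simp del: to_ac_diff)
    have "power_reduction Z {} m (\<lambda>j. w / (M * c j)) (\<lambda>_ _. 0)"
    proof
      show "m > 0" using m by simp
      fix j x assume x: "x \<in> Z"
      have "to_ac M * to_ac (c j) * x j ^ m = to_ac w"
        using eq[OF x, of j] w[OF x] by (simp add: M_def)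
      then show "x j ^ m = to_ac (w / (M * c j)) + (\<Sum>s\<in>{}. to_ac 0 * x s ^ m)"
        using M c[of j] by (simp add: field_simps)
    qed
    then show ?thesis by (intro exI conjI) auto
  qed
qed

section \<open>The dimension bound\<close>

theorem theorem3p1:
  fixes a b :: "'q::{field, finite}"
    and c :: "'n::finite \<Rightarrow> 'q"
    and m k :: nat
    and f :: "('q, 'n) mpol"
  assumes "CARD('n) \<ge> 3" and "m \<ge> 2" and "k \<ge> 2"
    and "\<not> CHAR('q) dvd m * k"
    and "m * k > CARD('n)"
    and "a \<noteq> 0" and "b \<noteq> 0" and "\<And>i. c i \<noteq> 0"
    and "f = ((\<Sum>i\<in>UNIV. Const (c i) * Var i ^ m) + Const a) ^ k - Const b * (\<Prod>i\<in>UNIV. Var i)"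
  shows "variety_dim (singular_locus f) \<le> ereal (real CARD('n) - 3)"
  unfolding variety_dim_def
proof (rule Sup_least)
  fix w assume "w \<in> {ereal (real r) | r. \<exists>Z. (\<forall>i\<le>r. irreducible_variety (Z i) \<and> Z i \<subseteq> singular_locus f)
      \<and> (\<forall>i<r. Z i \<subset> Z (Suc i))}"
  then obtain r Z where w: "w = ereal (real r)"
    and Z: "\<And>i. i \<le> r \<Longrightarrow> irreducible_variety (Z i)" "\<And>i. i \<le> r \<Longrightarrow> Z i \<subseteq> singular_locus f"
    and chain: "\<And>i. i < r \<Longrightarrow> Z i \<subset> Z (Suc i)"
    by blast
  obtain S u v where S: "card S \<le> CARD('n) - 3" and "power_reduction (Z r) S m u v"
    using singular_locus_irreducible_power_reduction[OF assms(1-4,6-9) Z(1,2)[OF order_refl]]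
    by blast
  then interpret power_reduction "Z r" S m u v by simp
  have "r \<le> card S"
    using irreducible_chain_alg_independent[of r Z] Z(1) chain alg_independent_on_card_le by blast
  \<comment> \<open>Having at least three variables makes the natural-number subtraction in the
    bound on \<open>card S\<close> agree with the real one.\<close>
  with S assms(1) show "w \<le> ereal (real CARD('n) - 3)"
    by (simp add: w)
qed

end
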